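(* Let $n\ge 1$ be an integer, let $c_k=\binom{k+3}{3}$ for $k\ge 1$, and let $R_n(c_k)$ be the $n\times n$ matrix whose $(i,j)$-entry is $1/c_{i+j-1}=1/\binom{i+j+2}{3}$ for $1\le i,j\le n$. Let $C(n)$ be the $n\times n$ matrix whose $(i,j)$-entry ($1\le i,j\le n$) is $$C_{ij}(n)=\sum_{k=0}^{j-1}(-1)^{i+k+1}\binom{n+i+2}{i+k+1}\binom{n+k+1}{i+k+1}\binom{i+k+1}{i}\binom{i+k}{i}\frac{i(j-k)}{3}.$$ Then every $C_{ij}(n)$ is an integer, and $C(n)$ is the inverse of the matrix $R_n(c_k)$. *)

theory Defs
  imports "Jordan_Normal_Form.Matrix"
begin

(* Matrices of the type 'a mat are indexed from 0, whereas the mathematics indexes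
   rows and columns from 1; hence the shifts by Suc below. *)

definition recip_hankel :: "nat \<Rightarrow> (nat \<Rightarrow> rat) \<Rightarrow> rat mat" where
  "recip_hankel n c = mat n n (\<lambda>(i, j). 1 / c (Suc i + Suc j - 1))"

definition tetra :: "nat \<Rightarrow> rat" where
  "tetra k = of_nat ((k + 3) choose 3)"

(* The arguments i and j of C_entry are the 1-based ones. *)
definition C_entry :: "nat \<Rightarrow> nat \<Rightarrow> nat \<Rightarrow> rat" where
  "C_entry n i j = (\<Sum>k = 0..<j.
     (-1) ^ (i + k + 1)
     * of_nat ((n + i + 2) choose (i + k + 1))
     * of_nat ((n + k + 1) choose (i + k + 1))
     * of_nat ((i + k + 1) choose i)
     * of_nat ((i + k) choose i)
     * (of_nat i * (of_nat j - of_nat k) / 3))"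

definition C_mat :: "nat \<Rightarrow> rat mat" where
  "C_mat n = mat n n (\<lambda>(i, j). C_entry n (Suc i) (Suc j))"

end

theory Submission
  imports Defs "Jordan_Normal_Form.Determinant" "HOL-Computational_Algebra.Primes"
begin

text \<open>
  As a function of \<open>j\<close>, the entry \<open>C_entry n i j\<close> is the double sum of coefficients
  \<open>a(i, k) = C_coeff n i k\<close>, so it
  suffices to show that \<open>a(i, k)\<close> is an integer and that the sum over \<open>l\<close> of \<open>a(l, k) / tetra (i + l - 1)\<close>
  is the second difference of the Kronecker delta.

  For the latter, \<open>a(l, k) / tetra (i + l - 1)\<close> is, up to a factor independent of \<open>l\<close>,
  the summand at the node \<open>-l\<close> of the divided difference of
  \<open>h(x) = (\<Prod>m\<in>{1..n+2} - {i, i+1, i+2}. x - m)\<close> at the \<open>n + 1\<close> nodes \<open>-1, ..., -n, k + 1\<close>. It vanishes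
  because \<open>h\<close> has degree \<open>n - 1\<close>, so the sum over \<open>l\<close> is determined by \<open>h(k + 1)\<close>, which is nonzero
  only for \<open>k + 1\<close> in \<open>{i, i+1, i+2}\<close>.

  For integrality, if \<open>3\<close> divided none of the factors of \<open>3 a(i, k)\<close>, then by Lucas'
  criterion on the last base-\<open>3\<close> digits \<open>i \<equiv> 1\<close>, \<open>k \<equiv> 0\<close>, \<open>n \<equiv> 2\<close> modulo \<open>3\<close>, and then
  \<open>n + k + 1 \<equiv> 0\<close> while \<open>i + k + 1 \<equiv> 2\<close>, a contradiction.
\<close>

section \<open>Divided differences of polynomials of low degree\<close>

lemma sum_poly_div_prod_diff_eq_0:
  fixes p :: "'a::field poly" and x :: "'b \<Rightarrow> 'a"
  assumes fin: "finite I" and inj: "inj_on x I" and deg: "Suc (degree p) < card I"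
  shows "(\<Sum>s\<in>I. poly p (x s) / (\<Prod>t\<in>I - {s}. x s - x t)) = 0"
proof -
  define w where "w s = (\<Prod>t\<in>I - {s}. x s - x t)" for s
  define L where "L s = (\<Prod>t\<in>I - {s}. [:- x t, 1:])" for s
  \<comment> \<open>\<open>q\<close> is the Lagrange interpolant of \<open>p\<close> at the nodes,
    so \<open>q = p\<close> because \<open>degree p\<close> is less than the number of nodes. Each
    \<open>L s\<close> is monic of degree \<open>card I - 1\<close>, hence the claimed sum is the
    coefficient of \<open>q\<close> in that degree, where \<open>p\<close> has coefficient
    zero.\<close>
  define q where "q = (\<Sum>s\<in>I. smult (poly p (x s) / w s) (L s))"
  have w_nz: "w s \<noteq> 0" if "s \<in> I" for s
    using that fin inj by (auto simp: w_def inj_on_def)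
  have deg_L: "degree (L s) = card I - 1" if "s \<in> I" for s
    unfolding L_def using fin that by (subst degree_prod_eq_sum_degree) auto
  have lead_L: "coeff (L s) (card I - 1) = 1" if "s \<in> I" for s
    using lead_coeff_prod[of "\<lambda>t. [:- x t, 1:]" "I - {s}"] deg_L[OF that]
    by (simp add: L_def)
  have eval_L: "poly (L s) (x r) = (if r = s then w s else 0)" if "s \<in> I" "r \<in> I" for s r
    using that fin by (auto simp: L_def w_def poly_prod)
  have eval_q: "poly q (x r) = poly p (x r)" if "r \<in> I" for r
  proof -
    have "poly q (x r) = (\<Sum>s\<in>I. if r = s then poly p (x s) else 0)"
      unfolding q_def poly_sum using that w_nz by (intro sum.cong) (auto simp: eval_L)
    then show ?thesis using that fin by simp
  qed
  have "degree q \<le> card I - 1"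
    unfolding q_def using deg_L by (intro degree_sum_le fin) (auto intro: order.trans[OF degree_smult_le])
  moreover have card: "card (x ` I) = card I" by (rule card_image[OF inj])
  ultimately have "q = p"
    using deg eval_q by (intro poly_eqI_degree[where A = "x ` I"]) auto
  moreover have "coeff q (card I - 1) = (\<Sum>s\<in>I. poly p (x s) / w s)"
    unfolding q_def coeff_sum using lead_L by (intro sum.cong) simp_all
  moreover have "coeff p (card I - 1) = 0"
    using deg by (intro coeff_eq_0) auto
  ultimately show ?thesis by (simp add: w_def)
qed

section \<open>Products over integer nodes and the divided difference built from them\<close>

lemma prod_diff_others_eq_fact:
  fixes l n :: nat
  assumes "1 \<le> l" "l \<le> n"
  shows "(\<Prod>m\<in>{1..n} - {l}. of_nat l - of_nat m) = ((-1) ^ (n - l) * fact (l - 1) * fact (n - l) :: 'a::{comm_ring_1,semiring_char_0})"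
  using assms(2)
proof (induction n rule: dec_induct)
  case base
  have "(\<Prod>m\<in>{1..l} - {l}. of_nat l - of_nat m :: 'a) = (\<Prod>m\<in>{1..l-1}. of_nat m)"
    using assms(1)
    by (intro prod.reindex_bij_witness[where i = "\<lambda>m. l - m" and j = "\<lambda>m. l - m"])
       (auto simp: of_nat_diff)
  then show ?case by (simp add: fact_prod)
next
  case (step n)
  have "{1..Suc n} - {l} = insert (Suc n) ({1..n} - {l})" using step by auto
  then have "(\<Prod>m\<in>{1..Suc n} - {l}. of_nat l - of_nat m :: 'a)
      = (of_nat l - of_nat (Suc n)) * ((-1) ^ (n - l) * fact (l - 1) * fact (n - l))"
    using step by simp
  also have "of_nat l - of_nat (Suc n) = - (of_nat (Suc (n - l)) :: 'a)"
    using step by (simp add: of_nat_diff)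
  finally show ?case using step by (simp add: Suc_diff_le algebra_simps)
qed

lemma prod_of_nat_add_eq_fact:
  "(\<Prod>m\<in>{1..n}. of_nat x + of_nat m) = (fact (n + x) / fact x :: 'a::field_char_0)"
proof (induction n)
  case (Suc n)
  have "(\<Prod>m\<in>{1..Suc n}. of_nat x + of_nat m :: 'a) = fact (n + x) / fact x * of_nat (Suc n + x)"
    using Suc by (simp add: add_ac)
  then show ?case by (simp add: mult_ac)
qed simp

lemma prod_minus_of_nat_add:
  "(\<Prod>m\<in>A. - of_nat x - of_nat m) = ((-1) ^ card A * (\<Prod>m\<in>A. of_nat x + of_nat m) :: 'a::comm_ring_1)"
proof -
  have "(\<Prod>m\<in>A. - of_nat x - of_nat m :: 'a) = (\<Prod>m\<in>A. (-1) * (of_nat x + of_nat m))"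
    by (intro prod.cong) auto
  then show ?thesis by (simp only: prod.distrib prod_constant)
qed

text \<open>Sign bookkeeping for the term at the node \<open>-l\<close>: \<open>e\<close> is
  (-1)^(n-1), which occurs in numerator and denominator and cancels; \<open>s\<close> is (-1)^(n-l),
  which is its own inverse and moves to the numerator.\<close>

lemma divide_signs_cancel:
  fixes e s P F D Y f g :: "'a::field_char_0"
  assumes "e * e = 1" "s * s = 1"
  shows "e * (P / (F * D)) / (- Y * (e * (s * f * g))) = - (s * P / (F * f * g * Y * D))"
proof -
  have "e = 1 \<or> e = -1" "s = 1 \<or> s = -1" using assms by (simp_all add: square_eq_1_iff)
  then show ?thesis by (auto simp: mult_ac)
qed

text \<open>This is the vanishing divided difference solved for the terms at the negative nodes; the
  right-hand side is the term at the remaining node \<open>y\<close>.\<close>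

lemma sum_fact_div_linear_factors:
  fixes n i y :: nat
  assumes i: "1 \<le> i" "i \<le> n" and y: "1 \<le> y"
  shows "(\<Sum>l=1..n. (-1) ^ l * fact (n + l + 2) /
            (fact l * fact (l - 1) * fact (n - l) * of_nat (l + y)
              * (of_nat (l + i) * of_nat (l + i + 1) * of_nat (l + i + 2))))
         = ((-1) ^ n * fact y / fact (n + y) * (\<Prod>m\<in>{1..n+2} - {i, i+1, i+2}. of_nat y - of_nat m) :: 'a::field_char_0)"
    (is "sum ?E _ = _ * ?h")
proof -
  let ?M = "{1..n+2} - {i, i+1, i+2}"
  define p :: "'a poly" where "p = (\<Prod>m\<in>?M. [:- of_nat m, 1:])"
  \<comment> \<open>Index 0 carries the node \<open>y\<close>, and every other index
    \<open>s\<close> carries the node \<open>-s\<close>; they are distinct because \<open>y\<close>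
    is positive.\<close>
  define x :: "nat \<Rightarrow> 'a" where "x s = (if s = 0 then of_nat y else - of_nat s)" for s
  have card_M: "card ?M = n - 1"
    using i by (subst card_Diff_subset) auto
  have "degree p = n - 1"
    unfolding p_def using card_M by (subst degree_prod_eq_sum_degree) auto
  moreover have "inj_on x {..n}"
  proof (rule inj_onI)
    have neq: "(of_nat y :: 'a) \<noteq> - of_nat b" for b :: nat
      using y by (metis add_eq_0_iff2 add_is_0 not_one_le_zero of_nat_0_eq_iff of_nat_add)
    fix s t assume "x s = x t"
    then show "s = t"
      using neq[of s] neq[of t] neq[of s, symmetric] by (cases "s = 0"; cases "t = 0") (simp_all add: x_def)
  qed
  ultimately have 0: "(\<Sum>s\<in>{..n}. poly p (x s) / (\<Prod>t\<in>{..n} - {s}. x s - x t)) = 0"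
    using i by (intro sum_poly_div_prod_diff_eq_0) auto
  have eval: "poly p z = (\<Prod>m\<in>?M. z - of_nat m)" for z
    by (simp add: p_def poly_prod)
  have "{..n} - {0} = {1..n}" by auto
  then have term_0: "(\<Prod>t\<in>{..n} - {0}. x 0 - x t) = fact (n + y) / fact y"
    by (simp add: x_def prod_of_nat_add_eq_fact[symmetric])
  have term_l: "poly p (x l) / (\<Prod>t\<in>{..n} - {l}. x l - x t) = - ((-1) ^ n * ?E l)" if l: "l \<in> {1..n}" for l
  proof -
    have "{..n} - {l} = insert 0 ({1..n} - {l})" using l by auto
    then have "(\<Prod>t\<in>{..n} - {l}. x l - x t) = - of_nat (l + y) * (\<Prod>t\<in>{1..n} - {l}. - of_nat l + of_nat t)"
      using l by (simp add: x_def)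
    also have "(\<Prod>t\<in>{1..n} - {l}. - of_nat l + of_nat t :: 'a) = (\<Prod>t\<in>{1..n} - {l}. (-1) * (of_nat l - of_nat t))"
      by (intro prod.cong) auto
    also have "\<dots> = (-1) ^ (n - 1) * ((-1) ^ (n - l) * fact (l - 1) * fact (n - l))"
      using l prod_diff_others_eq_fact[of l n, where ?'a = 'a] by (simp only: prod.distrib prod_constant) auto
    finally have den: "(\<Prod>t\<in>{..n} - {l}. x l - x t)
        = - of_nat (l + y) * ((-1) ^ (n - 1) * ((-1) ^ (n - l) * fact (l - 1) * fact (n - l)))" .
    \<comment> \<open>Restoring the three omitted factors gives the full product (n+l+2)!/l!, so the
      product over \<open>?M\<close> is this quotient divided by three consecutive nonzero
      factors.\<close>
    have "{1..n+2} = insert i (insert (i+1) (insert (i+2) ?M))" using i by auto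
    then have "(\<Prod>m\<in>{1..n+2}. of_nat l + of_nat m :: 'a)
        = (\<Prod>m\<in>insert i (insert (i+1) (insert (i+2) ?M)). of_nat l + of_nat m)"
      by (simp only:)
    also have "\<dots> = (of_nat (l + i) * of_nat (l + i + 1) * of_nat (l + i + 2)) * (\<Prod>m\<in>?M. of_nat l + of_nat m)"
      by (subst prod.insert, simp, simp)+ (simp only: of_nat_add add.assoc mult.assoc)
    finally have "fact (n + l + 2) / fact l
        = (of_nat (l + i) * of_nat (l + i + 1) * of_nat (l + i + 2)) * (\<Prod>m\<in>?M. of_nat l + of_nat m :: 'a)"
      unfolding prod_of_nat_add_eq_fact by (simp only: add_ac)
    moreover have "(of_nat (l + i) * of_nat (l + i + 1) * of_nat (l + i + 2) :: 'a) \<noteq> 0"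
      using l by (simp only: mult_eq_0_iff of_nat_eq_0_iff) auto
    moreover have "P = a / (b * c)" if "a / b = c * P" "c \<noteq> 0" for a b c P :: 'a
      using that by (metis nonzero_mult_div_cancel_left divide_divide_eq_left)
    ultimately have prod_M: "(\<Prod>m\<in>?M. of_nat l + of_nat m :: 'a)
        = fact (n + l + 2) / (fact l * (of_nat (l + i) * of_nat (l + i + 1) * of_nat (l + i + 2)))"
      by blast
    have "x l = - of_nat l" using l by (simp add: x_def)
    then have num: "poly p (x l) = (-1) ^ (n - 1) *
        (fact (n + l + 2) / (fact l * (of_nat (l + i) * of_nat (l + i + 1) * of_nat (l + i + 2))))"
      by (simp only: eval prod_minus_of_nat_add card_M prod_M)
    have sgn: "(-1) ^ (n - l) = ((-1) ^ n * (-1) ^ l :: 'a)"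
      using l by (simp add: minus_one_power_iff)
    have "poly p (x l) / (\<Prod>t\<in>{..n} - {l}. x l - x t) = - (((-1) ^ n * (-1) ^ l) * fact (n + l + 2) /
            (fact l * fact (l - 1) * fact (n - l) * of_nat (l + y)
              * (of_nat (l + i) * of_nat (l + i + 1) * of_nat (l + i + 2))))"
      unfolding num den sgn by (rule divide_signs_cancel) (simp_all add: minus_one_power_iff)
    then show ?thesis by (simp only: mult.assoc times_divide_eq_right)
  qed
  have "{..n} = insert 0 {1..n}" by auto
  then have "(\<Sum>s\<in>{..n}. poly p (x s) / (\<Prod>t\<in>{..n} - {s}. x s - x t))
      = poly p (x 0) / (\<Prod>t\<in>{..n} - {0}. x 0 - x t) + (\<Sum>s\<in>{1..n}. poly p (x s) / (\<Prod>t\<in>{..n} - {s}. x s - x t))"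
    by simp
  also have "(\<Sum>s\<in>{1..n}. poly p (x s) / (\<Prod>t\<in>{..n} - {s}. x s - x t)) = (\<Sum>s\<in>{1..n}. - ((-1) ^ n * ?E s))"
    by (rule sum.cong[OF refl term_l])
  also have "\<dots> = - ((-1) ^ n * sum ?E {1..n})"
    by (simp only: sum_negf sum_distrib_left)
  also have "poly p (x 0) = ?h" by (simp add: eval x_def)
  finally have "?h / (fact (n + y) / fact y) + - ((-1) ^ n * sum ?E {1..n}) = 0"
    unfolding 0 term_0 by (rule sym)
  then have "(-1) ^ n * sum ?E {1..n} = ?h / (fact (n + y) / fact y)"
    by (simp only: add_uminus_conv_diff right_minus_eq)
  moreover have "S = e * G / F * H" if "e * S = H / (F / G)" "e * e = 1" for e F G H S :: 'a
  proof -
    have "S = e * (e * S)" using that(2) by (simp flip: mult.assoc)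
    then show ?thesis unfolding that(1) by (simp add: mult_ac)
  qed
  moreover have "(-1) ^ n * (-1) ^ n = (1 :: 'a)" by (simp add: minus_one_power_iff)
  ultimately show ?thesis by blast
qed

section \<open>Integrality: divisibility by 3 of the numerators\<close>

lemma prime_dvd_binomial_if_mod_less:
  fixes p m r :: nat
  assumes "prime p" and less: "m mod p < r mod p"
  shows "p dvd m choose r"
proof -
  let ?q = "p * (m div p)"
  \<comment> \<open>Vandermonde for m = \<open>?q\<close> + m mod p, where p divides
    \<open>?q\<close>, is split term by term. If p divides k, then r - k has the residue of r, so it
    exceeds m mod p and the second factor vanishes. Otherwise k * (\<open>?q\<close> choose k) is a
    multiple of \<open>?q\<close>, and p divides the first factor.\<close>
  have "p dvd (?q choose k) * ((m mod p) choose (r - k))" if "k \<le> r" for k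
  proof (cases "p dvd k")
    case True
    then have "(r - k) mod p = r mod p" using that by (metis mod_eq_dvd_iff_nat diff_diff_cancel diff_le_self)
    then have "m mod p < r - k" using less by (metis mod_less_eq_dividend order.strict_trans2)
    then show ?thesis by (simp only: binomial_eq_0 mult_0_right dvd_0_right)
  next
    case False
    then have "0 < k" by (intro gr0I) auto
    then have "p dvd k * (?q choose k)" by (simp add: times_binomial_minus1_eq)
    then show ?thesis using False \<open>prime p\<close> by (simp add: prime_dvd_mult_iff)
  qed
  then have "p dvd (\<Sum>k\<le>r. (?q choose k) * ((m mod p) choose (r - k)))" by (intro dvd_sum) auto
  then show ?thesis unfolding vandermonde by simp
qed

lemma three_dvd_entry_product:
  fixes n i k :: nat
  shows "3 dvd ((n + i + 2) choose (i + k + 1)) * ((n + k + 1) choose (i + k + 1))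
    * ((i + k + 1) choose i) * ((i + k) choose i) * i"
proof (rule ccontr)
  have *: "r mod 3 \<le> m mod 3" if "\<not> 3 dvd m choose r" for m r :: nat
    using that prime_dvd_binomial_if_mod_less[of 3 m r] by (force simp: not_le)
  assume "\<not> ?thesis"
  then have "\<not> 3 dvd (n + i + 2) choose (i + k + 1)" "\<not> 3 dvd (n + k + 1) choose (i + k + 1)"
    "\<not> 3 dvd (i + k + 1) choose i" "\<not> 3 dvd (i + k) choose i" "\<not> 3 dvd i"
    by (meson dvd_mult dvd_mult2)+
  then have le: "(i + k + 1) mod 3 \<le> (n + i + 2) mod 3" "(i + k + 1) mod 3 \<le> (n + k + 1) mod 3"
    "i mod 3 \<le> (i + k + 1) mod 3" "i mod 3 \<le> (i + k) mod 3" and "i mod 3 \<noteq> 0"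
    using * by (blast, blast, blast, blast, simp add: dvd_eq_mod_eq_0)
  have "(a + b + c) mod 3 = (a mod 3 + b mod 3 + c) mod 3" for a b c :: nat by (metis mod_add_eq mod_add_left_eq)
  from this[of i k 1] this[of i k 0] this[of n i 2] this[of n k 1]
  have mods: "(i + k + 1) mod 3 = (i mod 3 + k mod 3 + 1) mod 3" "(i + k) mod 3 = (i mod 3 + k mod 3) mod 3"
    "(n + i + 2) mod 3 = (n mod 3 + i mod 3 + 2) mod 3" "(n + k + 1) mod 3 = (n mod 3 + k mod 3 + 1) mod 3"
    by (simp_all only: add_0_right)
  \<comment> \<open>Each of the 27 residue triples of i, k, n contradicts one of the four
    inequalities or \<open>i mod 3 \<noteq> 0\<close>.\<close>
  have "m mod 3 = 0 \<or> m mod 3 = 1 \<or> m mod 3 = 2" for m :: nat by presburger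
  from this[of i] this[of k] this[of n] show False
    using le \<open>i mod 3 \<noteq> 0\<close> unfolding mods by (elim disjE) simp_all
qed

text \<open>The coefficient of j - k in \<open>C_entry n i j\<close>. The factor i/3 stays with it,
  so that the coefficient itself is an integer.\<close>

definition C_coeff :: "nat \<Rightarrow> nat \<Rightarrow> nat \<Rightarrow> rat" where
  "C_coeff n i k = (-1) ^ (i + k + 1)
     * of_nat ((n + i + 2) choose (i + k + 1)) * of_nat ((n + k + 1) choose (i + k + 1))
     * of_nat ((i + k + 1) choose i) * of_nat ((i + k) choose i) * of_nat i / 3"

lemma C_entry_eq: "C_entry n i j = (\<Sum>k<j. of_nat (j - k) * C_coeff n i k)"
  unfolding C_entry_def atLeast0LessThan
  by (intro sum.cong) (auto simp: C_coeff_def of_nat_diff)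

lemma C_coeff_in_Ints: "C_coeff n i k \<in> \<int>"
proof -
  obtain d where d: "((n + i + 2) choose (i + k + 1)) * ((n + k + 1) choose (i + k + 1))
    * ((i + k + 1) choose i) * ((i + k) choose i) * i = 3 * d"
    using three_dvd_entry_product by (metis dvdE)
  have "C_coeff n i k = (-1) ^ (i + k + 1) * of_nat (((n + i + 2) choose (i + k + 1)) * ((n + k + 1) choose (i + k + 1))
    * ((i + k + 1) choose i) * ((i + k) choose i) * i) / 3"
    by (simp only: C_coeff_def of_nat_mult mult.assoc)
  also have "\<dots> = (-1) ^ (i + k + 1) * of_nat d" unfolding d by simp
  finally show ?thesis by simp
qed

lemma C_entry_in_Ints: "C_entry n i j \<in> \<int>"
  unfolding C_entry_eq by (intro Ints_sum Ints_mult C_coeff_in_Ints) auto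

section \<open>Sums of the coefficients and entries against the reciprocals of
  \<open>tetra\<close>\<close>

lemma C_coeff_eq_fact:
  assumes l: "1 \<le> l" "l \<le> n" and k: "k \<le> n"
  shows "C_coeff n l k = (-1) ^ (k + 1) * fact (n + k + 1) / (3 * fact (n + 1 - k) * fact k * fact (k + 1))
    * ((-1) ^ l * fact (n + l + 2) / (fact l * fact (l - 1) * fact (n - l) * of_nat (l + (k + 1))))"
proof -
  have choose: "of_nat ((n + l + 2) choose (l + k + 1)) = (fact (n + l + 2) / (fact (l + k + 1) * fact (n + 1 - k)) :: rat)"
    "of_nat ((n + k + 1) choose (l + k + 1)) = (fact (n + k + 1) / (fact (l + k + 1) * fact (n - l)) :: rat)"
    "of_nat ((l + k + 1) choose l) = (fact (l + k + 1) / (fact l * fact (k + 1)) :: rat)"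
    "of_nat ((l + k) choose l) = (fact (l + k) / (fact l * fact k) :: rat)"
    using l k by (simp_all add: binomial_fact del: fact_Suc binomial_Suc_Suc)
  have fact: "fact (l + k + 1) = (of_nat (l + (k + 1)) * fact (l + k) :: rat)"
    "fact l = (of_nat l * fact (l - 1) :: rat)"
    using l by (simp_all add: fact_reduce[of l])
  \<comment> \<open>\<open>Y\<close> stands for l+k+1, \<open>B\<close> for (l+k)!, \<open>L\<close>
    for l and \<open>F\<close> for (l-1)!. After cancellation all dependence on l sits in the last
    factor, which is the summand of \<open>sum_fact_div_linear_factors\<close> at y = k+1 without
    the three factors that \<open>tetra\<close> supplies.\<close>
  have cancel: "e * u * (N1 / (Y * B * Q1)) * (N2 / (Y * B * Q2)) * (Y * B / (L * F * K1)) * (B / (L * F * K)) * L / 3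
      = u * N2 / (3 * Q1 * K * K1) * (e * N1 / (L * F * F * Q2 * Y))"
    if "Y \<noteq> 0" "B \<noteq> 0" "L \<noteq> 0" for e u N1 N2 Y B Q1 Q2 L F K1 K :: rat
    using that by (simp add: divide_simps)
  have sgn: "(-1) ^ (l + k + 1) = ((-1) ^ l * (-1) ^ (k + 1) :: rat)"
    by (simp add: power_add)
  show ?thesis
    unfolding C_coeff_def choose fact sgn
    by (rule cancel) (use l in \<open>simp_all only: of_nat_eq_0_iff fact_nonzero, auto\<close>)
qed

lemma inverse_tetra: "1 / tetra (Suc s) = 6 / (of_nat (s + 2) * of_nat (s + 3) * of_nat (s + 4))"
proof -
  have "of_nat ((s + 4) choose 3) = (fact (s + 4) / (fact 3 * fact (s + 1)) :: rat)"
    by (subst binomial_fact) auto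
  also have "fact (s + 4) = (of_nat (s + 2) * of_nat (s + 3) * of_nat (s + 4) * fact (s + 1) :: rat)"
    by (simp add: numeral_eq_Suc algebra_simps)
  also have "fact 3 = (6 :: rat)" by (simp add: fact_numeral)
  finally have "tetra (Suc s) = of_nat (s + 2) * of_nat (s + 3) * of_nat (s + 4) / 6"
    unfolding tetra_def by (simp add: add.commute)
  then show ?thesis by (simp only: divide_divide_eq_right mult_1)
qed

text \<open>If y is none of i, i+1, i+2, then m = y contributes a zero factor. Otherwise the product
  over all m other than y is divided by the two missing differences, whose product is 2, -1 or 2
  respectively.\<close>

lemma prod_diff_except_three:
  fixes n i y :: nat
  assumes i: "1 \<le> i" "i \<le> n" and y: "1 \<le> y" "y \<le> n + 2"
  shows "(\<Prod>m\<in>{1..n+2} - {i, i+1, i+2}. of_nat y - of_nat m) =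
    ((-1) ^ (n + 2 - y) * fact (y - 1) * fact (n + 2 - y) *
      (if y = i then 1/2 else if y = i + 1 then -1 else if y = i + 2 then 1/2 else 0) :: 'a::field_char_0)"
    (is "?h = ?r * _")
proof (cases "y \<in> {i, i+1, i+2}")
  case False
  then have "?h = 0" using y by (intro prod_zero) auto
  then show ?thesis using False by auto
next
  case True
  let ?M = "{1..n+2} - {i, i+1, i+2}"
  have r: "(\<Prod>m\<in>{1..n+2} - {y}. of_nat y - of_nat m) = ?r"
    using y by (rule prod_diff_others_eq_fact)
  consider "y = i" | "y = i + 1" | "y = i + 2" using True by auto
  then show ?thesis
  proof cases
    case 1
    then have "{1..n+2} - {y} = insert (i+1) (insert (i+2) ?M)" using i by auto
    then have "?r = (of_nat y - of_nat (i+1)) * ((of_nat y - of_nat (i+2)) * ?h)"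
      unfolding r[symmetric] by (simp only: prod.insert finite_insert finite_Diff finite_atLeastAtMost) simp
    also have "\<dots> = 2 * ?h" unfolding mult.assoc[symmetric] using 1 by simp
    finally show ?thesis using 1 by simp
  next
    case 2
    then have "{1..n+2} - {y} = insert i (insert (i+2) ?M)" using i by auto
    then have "?r = (of_nat y - of_nat i) * ((of_nat y - of_nat (i+2)) * ?h)"
      unfolding r[symmetric] by (simp only: prod.insert finite_insert finite_Diff finite_atLeastAtMost) simp
    also have "\<dots> = - ?h" unfolding mult.assoc[symmetric] using 2 by simp
    finally show ?thesis using 2 by simp
  next
    case 3
    then have "{1..n+2} - {y} = insert i (insert (i+1) ?M)" using i by auto
    then have "?r = (of_nat y - of_nat i) * ((of_nat y - of_nat (i+1)) * ?h)"
      unfolding r[symmetric] by (simp only: prod.insert finite_insert finite_Diff finite_atLeastAtMost) simp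
    also have "\<dots> = 2 * ?h" unfolding mult.assoc[symmetric] using 3 by simp
    finally show ?thesis using 3 by simp
  qed
qed

text \<open>The factor 6 from \<open>tetra\<close> over the 3 in the coefficient leaves 2, which
  turns the weights 1/2, -1, 1/2 of \<open>prod_diff_except_three\<close> at y = k+1 into 1, -2,
  1.\<close>

lemma sum_C_coeff_div_tetra:
  assumes i: "1 \<le> i" "i \<le> n" and k: "k < n"
  shows "(\<Sum>l=1..n. 1 / tetra (i + l - 1) * C_coeff n l k) =
    (if k + 1 = i then 1 else if k = i then -2 else if k = i + 1 then 1 else 0)"
proof -
  let ?c = "(-1) ^ (k + 1) * fact (n + k + 1) / (3 * fact (n + 1 - k) * fact k * fact (k + 1)) :: rat"
  let ?D = "\<lambda>l. of_nat (l + i) * of_nat (l + i + 1) * of_nat (l + i + 2) :: rat"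
  let ?d = "if k + 1 = i then 1/2 else if k + 1 = i + 1 then -1 else if k + 1 = i + 2 then 1/2 else 0 :: rat"
  have "1 / tetra (i + l - 1) * C_coeff n l k
      = 6 * ?c * ((-1) ^ l * fact (n + l + 2) / (fact l * fact (l - 1) * fact (n - l) * of_nat (l + (k + 1)) * ?D l))"
    if l: "l \<in> {1..n}" for l
  proof -
    have "i + l - 1 = Suc (l + i - 2)" "l + i - 2 + 2 = l + i" "l + i - 2 + 3 = l + i + 1" "l + i - 2 + 4 = l + i + 2"
      using i l by auto
    then have "1 / tetra (i + l - 1) = 6 / ?D l"
      by (simp only: inverse_tetra)
    moreover have "6 / D * (c * (N / Q)) = 6 * c * (N / (Q * D))" for D c N Q :: rat
      by (simp add: mult_ac)
    ultimately show ?thesis using l k by (simp only: C_coeff_eq_fact atLeastAtMost_iff less_imp_le)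
  qed
  then have "(\<Sum>l=1..n. 1 / tetra (i + l - 1) * C_coeff n l k)
      = 6 * ?c * (\<Sum>l=1..n. (-1) ^ l * fact (n + l + 2) / (fact l * fact (l - 1) * fact (n - l) * of_nat (l + (k + 1)) * ?D l))"
    unfolding sum_distrib_left by (rule sum.cong[OF refl])
  also have "\<dots> = 6 * ?c * ((-1) ^ n * fact (k + 1) / fact (n + (k + 1)) *
          ((-1) ^ (n + 2 - (k + 1)) * fact (k + 1 - 1) * fact (n + 2 - (k + 1)) * ?d))"
    using i k by (subst sum_fact_div_linear_factors, simp, simp, simp) (subst prod_diff_except_three, simp_all)
  also have "\<dots> = 2 * ?d"
  proof -
    have "6 * (u * N / (3 * Q * K * K1)) * (v * K1 / N * (w * K * Q * d)) = 2 * (u * v * w * d)"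
      if "N \<noteq> 0" "Q \<noteq> 0" "K \<noteq> 0" "K1 \<noteq> 0" for u v w d N Q K K1 :: rat
      using that by (simp add: divide_simps)
    moreover have "n + 2 - (k + 1) = n + 1 - k" "k + 1 - 1 = k" "n + (k + 1) = n + k + 1" by auto
    \<comment> \<open>The exponents add up to 2n+2, because \<open>k < n\<close> makes the
      subtraction exact.\<close>
    moreover have "(-1) ^ (k + 1) * (-1) ^ n * (-1) ^ (n + 1 - k) = (1 :: rat)"
      using k by (simp add: minus_one_power_iff)
    ultimately show ?thesis by (simp only: fact_nonzero not_False_eq_True mult_1)
  qed
  finally show ?thesis by auto
qed

text \<open>As a function of k, the ramp max(j-k, 0) is linear except for a kink at k = j, so its
  second difference centred at i is 1 for i = j and 0 otherwise.\<close>

lemma sum_C_entry_div_tetra: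
  assumes i: "1 \<le> i" "i \<le> n" and j: "1 \<le> j" "j \<le> n"
  shows "(\<Sum>l=1..n. 1 / tetra (i + l - 1) * C_entry n l j) = (if i = j then 1 else 0)"
proof -
  have "(\<Sum>l=1..n. 1 / tetra (i + l - 1) * C_entry n l j)
      = (\<Sum>l=1..n. \<Sum>k<j. of_nat (j - k) * (1 / tetra (i + l - 1) * C_coeff n l k))"
    by (simp add: C_entry_eq sum_distrib_left mult_ac)
  also have "\<dots> = (\<Sum>k<j. of_nat (j - k) * (\<Sum>l=1..n. 1 / tetra (i + l - 1) * C_coeff n l k))"
    by (subst sum.swap) (simp add: sum_distrib_left)
  also have "\<dots> = (\<Sum>k<j. (if k = i - 1 then of_nat (j - k) else 0)
      + (if k = i then - 2 * of_nat (j - k) else 0) + (if k = i + 1 then of_nat (j - k) else 0))"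
    using i j by (intro sum.cong refl, subst sum_C_coeff_div_tetra) auto
  also have "\<dots> = (if i = j then 1 else 0)"
    using i j by (auto simp: sum.distrib of_nat_diff not_less)
  finally show ?thesis .
qed

section \<open>The matrix identity and the two-sided inverse\<close>

lemma recip_hankel_mult_C_mat: "recip_hankel n tetra * C_mat n = 1\<^sub>m n"
proof (rule eq_matI)
  fix i j assume "i < dim_row (1\<^sub>m n :: rat mat)" "j < dim_col (1\<^sub>m n :: rat mat)"
  then have ij: "i < n" "j < n" by auto
  then have "(recip_hankel n tetra * C_mat n) $$ (i, j)
      = (\<Sum>l=0..<n. 1 / tetra (Suc i + Suc l - 1) * C_entry n (Suc l) (Suc j))"
    by (simp add: recip_hankel_def C_mat_def scalar_prod_def)
  also have "\<dots> = (\<Sum>l=1..n. 1 / tetra (Suc i + l - 1) * C_entry n l (Suc j))"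
    by (rule sum.reindex_bij_witness[where i = "\<lambda>l. l - 1" and j = Suc]) auto
  also have "\<dots> = 1\<^sub>m n $$ (i, j)"
    using ij by (subst sum_C_entry_div_tetra) auto
  finally show "(recip_hankel n tetra * C_mat n) $$ (i, j) = 1\<^sub>m n $$ (i, j)" .
qed (simp_all add: recip_hankel_def C_mat_def)

theorem theorem5p3:
  fixes n :: nat
  assumes "n \<ge> 1"
  shows "(\<forall>i<n. \<forall>j<n. C_mat n $$ (i, j) \<in> \<int>)
    \<and> inverts_mat (recip_hankel n tetra) (C_mat n)
    \<and> inverts_mat (C_mat n) (recip_hankel n tetra)"
proof -
  have carrier: "recip_hankel n tetra \<in> carrier_mat n n" "C_mat n \<in> carrier_mat n n"
    by (simp_all add: recip_hankel_def C_mat_def)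
  \<comment> \<open>For square matrices over a field a right inverse is also a left inverse.\<close>
  have "C_mat n * recip_hankel n tetra = 1\<^sub>m n"
    by (rule mat_mult_left_right_inverse[OF carrier recip_hankel_mult_C_mat])
  then show ?thesis
    using carrier recip_hankel_mult_C_mat by (auto simp: inverts_mat_def C_mat_def C_entry_in_Ints)
qed

end
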